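(* Let $D=(E,\mathcal{F})$ be a delta-matroid and let $<$ be any total order on $E$. For $F\in\mathcal{F}$, let $i(F)$ be the number of points of $E$ that are internal, active, and orientable with respect to $F$, and let $j(F)$ be the number of points of $E$ that are external, active, and orientable with respect to $F$. Then the two-variable Bollobás-Riordan polynomial $\tilde{R}(D;x,y)$ satisfies $$\tilde{R}(D;x,y)=\sum_{F\in\mathcal{F}} (x-1)^{(r_{\max}(E)-|F|)/2}\,(y-1)^{(|F|-r_{\min}(E))/2}\,x^{i(F)}\,y^{j(F)} .$$
   Context: A delta-matroid is a pair $D=(E,\mathcal{F})$ where $E$ is a finite set and $\mathcal{F}$ is a nonempty collection of subsets of $E$ (the feasible sets) such that for all $X,Y\in\mathcal{F}$ and $a\in X\Delta Y$ there exists $b\in X\Delta Y$, not necessarily distinct from $a$, with $X\Delta\{a,b\}\in\mathcal{F}$ ($\Delta$ is symmetric difference). For $X\subseteq E$ the twist is $D*X=(E,\{X\Delta F: F\in\mathcal{F}\})$, which is again a delta-matroid. For a delta-matroid $D$ with ground set $E$, $r_{\max}(E)$ and $r_{\min}(E)$ denote respectively the maximum and the minimum cardinality of a feasible set of $D$. Minors: a point in every feasible set is a coloop; a point in no feasible set is a loop. If $a$ is not a coloop, $D\setminus a=(E-a,\{F:F\in\mathcal{F},a\notin F\})$. If $a$ is not a loop, $D/a=(E-a,\{F-a:F\in\mathcal{F},a\in F\})$. If $a$ is a loop, $D/a:=D\setminus a$; if $a$ is a coloop, $D\setminus a:=D/a$. The order in which points are deleted does not matter. For $A\subseteq E$, $D|A=D\setminus(E\setminus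 A)$. Bollobás-Riordan polynomial: $\sigma(D)=\frac12(r_{\max}(E)+r_{\min}(E))$; for $A\subseteq E$, $\sigma(A)=\sigma_D(A):=\sigma(D|A)$ (so $\sigma(E)=\sigma(D)$). Define $\tilde{R}(D;x,y)=\sum_{A\subseteq E}(x-1)^{\sigma(E)-\sigma(A)}(y-1)^{|A|-\sigma(A)}$. Exponents may be half-integers; the identity is understood with formal square roots of $x-1$ and $y-1$. Activities: fix $F\in\mathcal{F}$. A point $a\in E$ is $F$-nonorientable if $\{a\}$ is feasible in $D*F$, and $F$-orientable (orientable with respect to $F$) otherwise. A pair $\{a,b\}\subseteq E$, $a\neq b$, is $F$-paired if $\{a,b\}$ is feasible in $D*F$, and $F$-separated otherwise. Distinct points $a,b$ are $F$-interlaced if either (1) at most one of $a,b$ is $F$-nonorientable and $\{a,b\}$ is $F$-paired, or (2) both $a$ and $b$ are $F$-nonorientable and $\{a,b\}$ is $F$-separated. Given a total order $<$ on $E$, a point $a$ is active with respect to $F$ if $a$ is not $F$-interlaced with any lower-ordered point. A point $a$ is internal (with respect to $F$) if $a\in F$ and external otherwise. *)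

theory Defs
  imports Complex_Main
begin

text \<open>A set system is a pair consisting of a ground set and a collection of feasible sets.\<close>

type_synonym 'a set_system = "'a set \<times> 'a set set"

abbreviation ground :: "'a set_system \<Rightarrow> 'a set" where
  "ground D \<equiv> fst D"

abbreviation feasible :: "'a set_system \<Rightarrow> 'a set set" where
  "feasible D \<equiv> snd D"

definition delta_matroid :: "'a set_system \<Rightarrow> bool" where
  "delta_matroid D \<longleftrightarrow>
     finite (ground D) \<and> feasible D \<noteq> {} \<and> (\<forall>F\<in>feasible D. F \<subseteq> ground D) \<and>
     (\<forall>X\<in>feasible D. \<forall>Y\<in>feasible D. \<forall>a\<in>sym_diff X Y. \<exists>b\<in>sym_diff X Y.
        sym_diff X {a, b} \<in> feasible D)"

definition twist :: "'a set_system \<Rightarrow> 'a set \<Rightarrow> 'a set_system" where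
  "twist D X = (ground D, {sym_diff X F | F. F \<in> feasible D})"

definition r_max :: "'a set_system \<Rightarrow> nat" where
  "r_max D = Max (card ` feasible D)"

definition r_min :: "'a set_system \<Rightarrow> nat" where
  "r_min D = Min (card ` feasible D)"

definition coloop :: "'a set_system \<Rightarrow> 'a \<Rightarrow> bool" where
  "coloop D a \<longleftrightarrow> a \<in> ground D \<and> (\<forall>F\<in>feasible D. a \<in> F)"

definition loop :: "'a set_system \<Rightarrow> 'a \<Rightarrow> bool" where
  "loop D a \<longleftrightarrow> a \<in> ground D \<and> (\<forall>F\<in>feasible D. a \<notin> F)"

text \<open>Deletion of a loop and contraction of a coloop are given by the plain formulas, since
  with a nonempty collection of feasible sets no point is both a loop and a coloop.  The
  convention that the contraction of a loop is its deletion is therefore not circular.\<close>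

definition contract :: "'a set_system \<Rightarrow> 'a \<Rightarrow> 'a set_system" where
  "contract D a =
     (if loop D a then (ground D - {a}, {F. F \<in> feasible D \<and> a \<notin> F})
      else (ground D - {a}, {F - {a} | F. F \<in> feasible D \<and> a \<in> F}))"

definition delete :: "'a set_system \<Rightarrow> 'a \<Rightarrow> 'a set_system" where
  "delete D a =
     (if coloop D a then contract D a
      else (ground D - {a}, {F. F \<in> feasible D \<and> a \<notin> F}))"

text \<open>Points are deleted one after the other.  For a delta-matroid the result does not depend
  on the order, so the fold over a finite set is well defined; for an arbitrary set system it
  need not be.\<close>

definition delete_set :: "'a set_system \<Rightarrow> 'a set \<Rightarrow> 'a set_system" where
  "delete_set D X = Finite_Set.fold (\<lambda>a D'. delete D' a) D X"

definition restrict_to :: "'a set_system \<Rightarrow> 'a set \<Rightarrow> 'a set_system" where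
  "restrict_to D A = delete_set D (ground D - A)"

definition sigma :: "'a set_system \<Rightarrow> rat" where
  "sigma D = (of_nat (r_max D) + of_nat (r_min D)) / 2"

definition sigma_sub :: "'a set_system \<Rightarrow> 'a set \<Rightarrow> rat" where
  "sigma_sub D A = sigma (restrict_to D A)"

text \<open>If \<open>s\<close> is a square root of \<open>z\<close>, then \<open>half_pow s q\<close> is the power of \<open>z\<close> with exponent
  \<open>q\<close>, for \<open>q\<close> a nonnegative integer or half-integer.  All exponents occurring below are of
  this form when \<open>D\<close> is a delta-matroid, so nothing is rounded or truncated.\<close>

definition half_pow :: "'b::comm_ring_1 \<Rightarrow> rat \<Rightarrow> 'b" where
  "half_pow s q = s ^ nat \<lfloor>2 * q\<rfloor>"

text \<open>The Bollobas-Riordan polynomial is a polynomial in the formal square roots \<open>s\<close> of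
  \<open>x - 1\<close> and \<open>t\<close> of \<open>y - 1\<close>.  It is given by its value at elements \<open>s\<close>, \<open>t\<close> of an arbitrary
  commutative ring, which includes the case where \<open>s\<close> and \<open>t\<close> are indeterminates.\<close>

definition bollobas_riordan :: "'a set_system \<Rightarrow> 'b::comm_ring_1 \<Rightarrow> 'b \<Rightarrow> 'b" where
  "bollobas_riordan D s t =
     (\<Sum>A\<in>Pow (ground D).
        half_pow s (sigma_sub D (ground D) - sigma_sub D A) *
        half_pow t (of_nat (card A) - sigma_sub D A))"

definition nonorientable :: "'a set_system \<Rightarrow> 'a set \<Rightarrow> 'a \<Rightarrow> bool" where
  "nonorientable D F a \<longleftrightarrow> {a} \<in> feasible (twist D F)"

definition paired :: "'a set_system \<Rightarrow> 'a set \<Rightarrow> 'a \<Rightarrow> 'a \<Rightarrow> bool" where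
  "paired D F a b \<longleftrightarrow> a \<noteq> b \<and> {a, b} \<in> feasible (twist D F)"

definition interlaced :: "'a set_system \<Rightarrow> 'a set \<Rightarrow> 'a \<Rightarrow> 'a \<Rightarrow> bool" where
  "interlaced D F a b \<longleftrightarrow> a \<noteq> b \<and>
     (\<not> (nonorientable D F a \<and> nonorientable D F b) \<and> paired D F a b \<or>
      nonorientable D F a \<and> nonorientable D F b \<and> \<not> paired D F a b)"

text \<open>The order is a reflexive relation \<open>r\<close> on the ground set, with \<open>(b, a) \<in> r\<close> for
  \<open>b \<le> a\<close>.\<close>

definition active :: "'a set_system \<Rightarrow> 'a rel \<Rightarrow> 'a set \<Rightarrow> 'a \<Rightarrow> bool" where
  "active D r F a \<longleftrightarrow> (\<forall>b\<in>ground D. (b, a) \<in> r \<and> b \<noteq> a \<longrightarrow> \<not> interlaced D F a b)"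

definition int_activity :: "'a set_system \<Rightarrow> 'a rel \<Rightarrow> 'a set \<Rightarrow> nat" where
  "int_activity D r F =
     card {a \<in> ground D. a \<in> F \<and> active D r F a \<and> \<not> nonorientable D F a}"

definition ext_activity :: "'a set_system \<Rightarrow> 'a rel \<Rightarrow> 'a set \<Rightarrow> nat" where
  "ext_activity D r F =
     card {a \<in> ground D. a \<notin> F \<and> active D r F a \<and> \<not> nonorientable D F a}"

end

theory Submission
  imports Defs
begin

text \<open>Write \<open>d(A)\<close> for the least size of \<open>A \<Delta> F\<close> over the feasible sets \<open>F\<close>.  Deleting a point
  outside \<open>A\<close> changes \<open>d(A)\<close> and \<open>d({})\<close> by the same amount, which gives
  \<open>2 \<sigma>(A) = |A| + d({}) - d(A)\<close>.  Let \<open>Act(F)\<close> be the set of active \<open>F\<close>-orientable points.  Every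
  \<open>A \<subseteq> E\<close> is \<open>F \<Delta> B\<close> for exactly one feasible \<open>F\<close> and one \<open>B \<subseteq> Act(F)\<close>, and then \<open>d(A) = |B|\<close>:
  twisting by \<open>A\<close> reduces this to \<open>A = {}\<close>, where one deletes the greatest point \<open>e\<close>, which by the
  exchange axiom belongs to \<open>Act(F)\<close> only if it is a loop or a coloop.  So the subsets of \<open>E\<close> fall
  into Boolean intervals indexed by the feasible sets.  In the interval of \<open>F\<close> each point of \<open>B\<close>
  contributes a factor \<open>x - 1\<close> if it lies in \<open>F\<close> and \<open>y - 1\<close> otherwise, so that the interval sums
  to the term of \<open>F\<close>.\<close>

section \<open>The exchange axiom and twists\<close>

lemma delta_matroidI:
  assumes "finite (ground D)" "feasible D \<noteq> {}" "\<And>F. F \<in> feasible D \<Longrightarrow> F \<subseteq> ground D"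
    and "\<And>X Y a. X \<in> feasible D \<Longrightarrow> Y \<in> feasible D \<Longrightarrow> a \<in> sym_diff X Y \<Longrightarrow>
      \<exists>b\<in>sym_diff X Y. sym_diff X {a, b} \<in> feasible D"
  shows "delta_matroid D"
  unfolding delta_matroid_def using assms by blast

lemma delta_matroid_exchange:
  assumes "delta_matroid D" "X \<in> feasible D" "Y \<in> feasible D" "a \<in> sym_diff X Y"
  obtains b where "b \<in> sym_diff X Y" "sym_diff X {a, b} \<in> feasible D"
  using assms unfolding delta_matroid_def by metis

lemma delta_matroid_finite_feasible:
  assumes "delta_matroid D" shows "finite (feasible D)"
  using assms unfolding delta_matroid_def
  by (meson PowI finite_Pow_iff finite_subset subsetI)

text \<open>Twisting leaves the symmetric difference of two feasible sets unchanged, so an exchange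
  partner found in \<open>D\<close> also serves in the twist.\<close>

lemma delta_matroid_twist:
  assumes D: "delta_matroid D" and A: "A \<subseteq> ground D"
  shows "delta_matroid (twist D A)"
proof (rule delta_matroidI)
  show "finite (ground (twist D A))" "feasible (twist D A) \<noteq> {}"
    using D unfolding delta_matroid_def twist_def by auto
  show "F \<subseteq> ground (twist D A)" if "F \<in> feasible (twist D A)" for F
    using that D A unfolding delta_matroid_def twist_def by auto
  fix X Y a
  assume X: "X \<in> feasible (twist D A)" and Y: "Y \<in> feasible (twist D A)" and a: "a \<in> sym_diff X Y"
  obtain X' Y' where X': "X = sym_diff A X'" "X' \<in> feasible D"
    and Y': "Y = sym_diff A Y'" "Y' \<in> feasible D"
    using X Y by (auto simp: twist_def)
  have eq: "sym_diff X Y = sym_diff X' Y'" unfolding X'(1) Y'(1) by blast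
  obtain b where b: "b \<in> sym_diff X' Y'" "sym_diff X' {a, b} \<in> feasible D"
    using delta_matroid_exchange[OF D X'(2) Y'(2)] a eq by metis
  have "sym_diff X {a, b} = sym_diff A (sym_diff X' {a, b})" unfolding X'(1) by blast
  then have "sym_diff X {a, b} \<in> feasible (twist D A)"
    using b(2) by (auto simp: twist_def)
  then show "\<exists>b\<in>sym_diff X Y. sym_diff X {a, b} \<in> feasible (twist D A)"
    using b(1) eq by blast
qed

lemma feasible_twist_iff: "A \<in> feasible (twist D F) \<longleftrightarrow> sym_diff F A \<in> feasible D"
proof -
  have "A = sym_diff F G \<longleftrightarrow> G = sym_diff F A" for G by blast
  then show ?thesis unfolding twist_def by simp
qed

section \<open>Deletion of points and its independence of order\<close>

lemma ground_delete [simp]: "ground (delete D a) = ground D - {a}"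
  by (simp add: delete_def contract_def)

text \<open>Some set is feasible, so a coloop is never a loop and the conventions reduce to one case
  distinction. A point outside the ground set falls under the first case, where no feasible set is
  lost.\<close>

lemma feasible_delete:
  assumes "delta_matroid D"
  shows "feasible (delete D a) =
    (if \<exists>F\<in>feasible D. a \<notin> F then {F \<in> feasible D. a \<notin> F} else (\<lambda>F. F - {a}) ` feasible D)"
proof -
  have "feasible D \<noteq> {}" "\<forall>F\<in>feasible D. F \<subseteq> ground D"
    using assms by (auto simp: delta_matroid_def)
  then have "coloop D a \<longleftrightarrow> \<not> (\<exists>F\<in>feasible D. a \<notin> F)" "coloop D a \<Longrightarrow> \<not> loop D a"
    unfolding coloop_def loop_def by blast+
  then show ?thesis by (auto simp: delete_def contract_def)
qed

text \<open>The exchange partner is sought in the symmetric difference of \<open>X\<close> and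
  \<open>Y\<close>. It never equals \<open>a\<close>, since either both sets avoid \<open>a\<close>
  or both come from sets containing it.\<close>

lemma delta_matroid_delete:
  assumes D: "delta_matroid D"
  shows "delta_matroid (delete D a)"
proof (rule delta_matroidI)
  note fd = feasible_delete[OF D, of a]
  have sub: "F \<subseteq> ground D" if "F \<in> feasible D" for F
    using that D by (auto simp: delta_matroid_def)
  show "finite (ground (delete D a))" using D by (simp add: delta_matroid_def)
  show "feasible (delete D a) \<noteq> {}" using D unfolding fd by (auto simp: delta_matroid_def)
  show "F \<subseteq> ground (delete D a)" if "F \<in> feasible (delete D a)" for F
    using that sub unfolding fd ground_delete by (auto split: if_splits)
  fix X Y c
  assume X: "X \<in> feasible (delete D a)" and Y: "Y \<in> feasible (delete D a)" and c: "c \<in> sym_diff X Y"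
  show "\<exists>b\<in>sym_diff X Y. sym_diff X {c, b} \<in> feasible (delete D a)"
  proof (cases "\<exists>F\<in>feasible D. a \<notin> F")
    case True
    then have X': "X \<in> feasible D" "a \<notin> X" and Y': "Y \<in> feasible D" "a \<notin> Y"
      using X Y by (auto simp: fd)
    obtain b where "b \<in> sym_diff X Y" "sym_diff X {c, b} \<in> feasible D"
      using delta_matroid_exchange[OF D X'(1) Y'(1) c] .
    then show ?thesis using True X' Y' c by (auto simp: fd intro!: bexI[of _ b])
  next
    case False
    then obtain X' Y' where X': "X = X' - {a}" "X' \<in> feasible D" and Y': "Y = Y' - {a}" "Y' \<in> feasible D"
      using X Y by (auto simp: fd)
    have a: "a \<in> X'" "a \<in> Y'" using False X' Y' by auto
    have eq: "sym_diff X Y = sym_diff X' Y'" using a X' Y' by blast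
    obtain b where b: "b \<in> sym_diff X' Y'" "sym_diff X' {c, b} \<in> feasible D"
      using delta_matroid_exchange[OF D X'(2) Y'(2)] c eq by metis
    have "sym_diff X {c, b} = sym_diff X' {c, b} - {a}" using X'(1) b(1) c a eq by auto
    then show ?thesis using False b eq by (auto simp: fd)
  qed
qed

text \<open>Exchanging \<open>F\<close> towards \<open>G\<close> at \<open>b\<close> removes
  \<open>b\<close>. The result must still meet \<open>{a, b}\<close>, which forces the partner to be
  \<open>a\<close>.\<close>

lemma delete_commute_aux:
  assumes D: "delta_matroid D" and "\<forall>F\<in>feasible D. a \<in> F \<or> b \<in> F"
    and "F \<in> feasible D" "a \<notin> F" "G \<in> feasible D" "b \<notin> G"
  shows "sym_diff F {a, b} \<in> feasible D"
proof -
  have "b \<in> F" "a \<in> G" using assms by auto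
  then have "b \<in> sym_diff F G" using assms by auto
  then obtain c where c: "c \<in> sym_diff F G" "sym_diff F {b, c} \<in> feasible D"
    using delta_matroid_exchange[OF D assms(3,5)] by metis
  have "a \<in> sym_diff F {b, c} \<or> b \<in> sym_diff F {b, c}" using bspec[OF assms(2) c(2)] .
  then have "c = a" using \<open>b \<in> F\<close> assms(4) by blast
  then show ?thesis using c(2) by (simp add: insert_commute)
qed

text \<open>The reverse inclusion arises by swapping \<open>a\<close> and \<open>b\<close>. In all
  cases but the last, each point is treated the same way in both orders.\<close>

lemma feasible_delete_delete_subset:
  assumes D: "delta_matroid D"
  shows "feasible (delete (delete D a) b) \<subseteq> feasible (delete (delete D b) a)"
proof -
  note fd = feasible_delete[OF D]
  note fdd = feasible_delete[OF delta_matroid_delete[OF D]]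
  consider "a = b" | F where "F \<in> feasible D" "a \<notin> F" "b \<notin> F"
    | (no_a) "a \<noteq> b" "\<forall>F\<in>feasible D. a \<in> F"
    | (no_b) "a \<noteq> b" "\<forall>F\<in>feasible D. b \<in> F"
    | (both) F G where "a \<noteq> b" "F \<in> feasible D" "a \<notin> F" "G \<in> feasible D" "b \<notin> G"
        "\<forall>F\<in>feasible D. a \<in> F \<or> b \<in> F"
    by blast
  then show ?thesis
  proof cases
    case 1
    then show ?thesis by simp
  next
    case (2 F)
    then have a: "feasible (delete D a) = {F \<in> feasible D. a \<notin> F}"
      and b: "feasible (delete D b) = {F \<in> feasible D. b \<notin> F}" by (auto simp: fd)
    have "feasible (delete (delete D a) b) = {F \<in> feasible (delete D a). b \<notin> F}"
      "feasible (delete (delete D b) a) = {F \<in> feasible (delete D b). a \<notin> F}"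
      unfolding fdd using 2 by (auto simp: a b)
    then show ?thesis by (auto simp: a b)
  next
    case no_a
    then have a: "feasible (delete D a) = (\<lambda>F. F - {a}) ` feasible D" by (auto simp: fd)
    show ?thesis
    proof (cases "\<exists>F\<in>feasible D. b \<notin> F")
      case True
      then have b: "feasible (delete D b) = {F \<in> feasible D. b \<notin> F}" by (auto simp: fd)
      have "feasible (delete (delete D a) b) = {F \<in> feasible (delete D a). b \<notin> F}"
        unfolding fdd using True by (auto simp: a)
      moreover have "feasible (delete (delete D b) a) = (\<lambda>F. F - {a}) ` feasible (delete D b)"
        unfolding fdd using no_a by (auto simp: b)
      ultimately show ?thesis using no_a(1) by (auto simp: a b)
    next
      case False
      then have b: "feasible (delete D b) = (\<lambda>F. F - {b}) ` feasible D" by (auto simp: fd)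
      have "feasible (delete (delete D a) b) = (\<lambda>F. F - {b}) ` feasible (delete D a)"
        unfolding fdd using False no_a by (auto simp: a)
      moreover have "feasible (delete (delete D b) a) = (\<lambda>F. F - {a}) ` feasible (delete D b)"
        unfolding fdd using no_a by (auto simp: b)
      moreover have "F - {a} - {b} = F - {b} - {a}" for F by blast
      ultimately show ?thesis by (simp add: a b image_image)
    qed
  next
    case no_b
    then have b: "feasible (delete D b) = (\<lambda>F. F - {b}) ` feasible D" by (auto simp: fd)
    show ?thesis
    proof (cases "\<exists>F\<in>feasible D. a \<notin> F")
      case True
      then have a: "feasible (delete D a) = {F \<in> feasible D. a \<notin> F}" by (auto simp: fd)
      have "feasible (delete (delete D b) a) = {F \<in> feasible (delete D b). a \<notin> F}"
        unfolding fdd using True by (auto simp: b)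
      moreover have "feasible (delete (delete D a) b) = (\<lambda>F. F - {b}) ` feasible (delete D a)"
        unfolding fdd using no_b by (auto simp: a)
      ultimately show ?thesis using no_b(1) by (auto simp: a b)
    next
      case False
      then have a: "feasible (delete D a) = (\<lambda>F. F - {a}) ` feasible D" by (auto simp: fd)
      have "feasible (delete (delete D a) b) = (\<lambda>F. F - {b}) ` feasible (delete D a)"
        unfolding fdd using no_b by (auto simp: a)
      moreover have "feasible (delete (delete D b) a) = (\<lambda>F. F - {a}) ` feasible (delete D b)"
        unfolding fdd using False no_b by (auto simp: b)
      moreover have "F - {a} - {b} = F - {b} - {a}" for F by blast
      ultimately show ?thesis by (simp add: a b image_image)
    qed
  next
    \<comment> \<open>Filtering by one point turns the other into a coloop, so the two orders keep
      different feasible sets. Toggling both points matches them.\<close>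
    case (both F G)
    then have a: "feasible (delete D a) = {F \<in> feasible D. a \<notin> F}"
      and b: "feasible (delete D b) = {F \<in> feasible D. b \<notin> F}" by (auto simp: fd)
    have ab: "feasible (delete (delete D a) b) = (\<lambda>F. F - {b}) ` {F \<in> feasible D. a \<notin> F}"
      unfolding fdd using both(6) by (auto simp: a)
    have ba: "feasible (delete (delete D b) a) = (\<lambda>F. F - {a}) ` {F \<in> feasible D. b \<notin> F}"
      unfolding fdd using both(6) by (auto simp: b)
    show ?thesis unfolding ab ba
    proof (rule image_subsetI)
      fix H assume "H \<in> {F \<in> feasible D. a \<notin> F}"
      then have H: "H \<in> feasible D" "a \<notin> H" by auto
      have "b \<in> H" using both(6) H by blast
      have "sym_diff H {a, b} \<in> feasible D" using delete_commute_aux[OF D both(6) H both(4,5)] .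
      moreover have "H - {b} = sym_diff H {a, b} - {a}" "b \<notin> sym_diff H {a, b}"
        using H(2) \<open>b \<in> H\<close> by auto
      ultimately show "H - {b} \<in> (\<lambda>F. F - {a}) ` {F \<in> feasible D. b \<notin> F}" by blast
    qed
  qed
qed

lemma delete_commute:
  assumes "delta_matroid D"
  shows "delete (delete D a) b = delete (delete D b) a"
  using feasible_delete_delete_subset[OF assms, of a b] feasible_delete_delete_subset[OF assms, of b a]
  by (intro prod_eqI) auto

lemma
  assumes D: "delta_matroid D" and X: "finite X"
  shows delta_matroid_delete_set: "delta_matroid (delete_set D X)"
    and delete_set_insert: "a \<notin> X \<Longrightarrow> delete_set D (insert a X) = delete (delete_set D X) a"
proof -
  \<comment> \<open>Deletions commute on delta-matroids only, whereas \<open>comp_fun_commute\<close> asks for all set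
    systems; hence the guard.\<close>
  define f where "f = (\<lambda>a D'. if delta_matroid D' then delete D' a else D' :: 'a set_system)"
  interpret comp_fun_commute f
    by standard (auto simp: f_def fun_eq_iff delta_matroid_delete delete_commute)
  \<comment> \<open>A fold started at \<open>D\<close> meets only delta-matroids, so the guarded and
    the plain fold agree.\<close>
  have eq: "delete_set D Y = Finite_Set.fold f D Y" for Y
    unfolding delete_set_def
    by (rule fold_closed_eq[where B = "{D. delta_matroid D}"])
       (auto simp: f_def D delta_matroid_delete)
  have dm: "delta_matroid (Finite_Set.fold f D X)"
    using X
  proof induction
    case (insert b Y)
    then have "Finite_Set.fold f D (insert b Y) = delete (Finite_Set.fold f D Y) b"
      unfolding fold_insert[OF insert.hyps] by (simp add: f_def)
    then show ?case using insert.IH delta_matroid_delete by simp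
  qed (simp add: D)
  then show "delta_matroid (delete_set D X)" using eq by simp
  show "delete_set D (insert a X) = delete (delete_set D X) a" if "a \<notin> X"
    unfolding eq fold_insert[OF X that] using dm by (simp add: f_def)
qed

section \<open>Distance to the feasible sets, and its change under deletion\<close>

text \<open>This is \<open>d(A)\<close> above; it equals \<open>r_min (twist D A)\<close>.\<close>

definition dist_feasible :: "'a set_system \<Rightarrow> 'a set \<Rightarrow> nat" where
  "dist_feasible D A = Min ((\<lambda>F. card (sym_diff A F)) ` feasible D)"

lemma dist_feasible_le:
  "delta_matroid D \<Longrightarrow> F \<in> feasible D \<Longrightarrow> dist_feasible D A \<le> card (sym_diff A F)"
  unfolding dist_feasible_def by (intro Min_le) (auto simp: delta_matroid_finite_feasible)

lemma dist_feasible_attained: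
  assumes "delta_matroid D"
  obtains F where "F \<in> feasible D" "dist_feasible D A = card (sym_diff A F)"
proof -
  have "dist_feasible D A \<in> (\<lambda>F. card (sym_diff A F)) ` feasible D"
    unfolding dist_feasible_def using assms
    by (intro Min_in) (auto simp: delta_matroid_finite_feasible delta_matroid_def)
  then show thesis using that by auto
qed

lemma dist_feasible_eqI:
  assumes "delta_matroid D" "F \<in> feasible D" "\<And>G. G \<in> feasible D \<Longrightarrow> card (sym_diff A F) \<le> card (sym_diff A G)"
  shows "dist_feasible D A = card (sym_diff A F)"
  by (metis assms dist_feasible_attained dist_feasible_le order_antisym)

text \<open>If \<open>e\<close> lies in \<open>Y\<close>, exchange \<open>Y\<close> towards
  \<open>X\<close> at \<open>e\<close>. Dropping \<open>e\<close> lowers the distance to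
  \<open>A\<close> by one, and the partner \<open>b\<close> raises it by at most one.\<close>

lemma exchange_nearer:
  assumes D: "delta_matroid D" and "X \<in> feasible D" "e \<notin> X" "Y \<in> feasible D" "e \<notin> A" "A \<subseteq> ground D"
  obtains Z where "Z \<in> feasible D" "e \<notin> Z" "card (sym_diff A Z) \<le> card (sym_diff A Y)"
proof (cases "e \<in> Y")
  case False
  then show thesis using that assms by blast
next
  case True
  then have "e \<in> sym_diff Y X" using assms by auto
  then obtain b where b: "b \<in> sym_diff Y X" "sym_diff Y {e, b} \<in> feasible D"
    using delta_matroid_exchange[OF D assms(4,2)] by metis
  have Y: "Y \<subseteq> ground D" "finite (ground D)" using D assms(4) by (auto simp: delta_matroid_def)
  have fin: "finite (sym_diff A Y)" by (rule finite_subset[OF _ Y(2)]) (use Y(1) assms(6) in auto)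
  have sub: "sym_diff A (sym_diff Y {e, b}) \<subseteq> insert b (sym_diff A Y - {e})"
    using True assms(5) by auto
  have "card (sym_diff A (sym_diff Y {e, b})) \<le> card (insert b (sym_diff A Y - {e}))"
    by (rule card_mono[OF _ sub]) (use fin in simp)
  also have "\<dots> \<le> Suc (card (sym_diff A Y - {e}))" by (rule card_insert_le_m1) simp_all
  also have "\<dots> = card (sym_diff A Y)"
    using fin True assms(5) by (intro card_Suc_Diff1) auto
  finally show thesis using that[OF b(2)] True by auto
qed

text \<open>Here \<open>k\<close> is 1 if \<open>e\<close> is a coloop and 0 otherwise.\<close>

lemma dist_feasible_delete:
  assumes D: "delta_matroid D" and e: "e \<in> ground D"
  obtains k where "\<And>A. A \<subseteq> ground D - {e} \<Longrightarrow> dist_feasible D A = dist_feasible (delete D e) A + k"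
proof (cases "\<exists>F\<in>feasible D. e \<notin> F")
  case True
  then obtain X where X: "X \<in> feasible D" "e \<notin> X" by blast
  \<comment> \<open>The feasible sets lost by the deletion contain \<open>e\<close>, and
    \<open>exchange_nearer\<close> replaces each of them by one avoiding \<open>e\<close> that is no
    farther from \<open>A\<close>.\<close>
  have "dist_feasible D A = dist_feasible (delete D e) A" if A: "A \<subseteq> ground D - {e}" for A
  proof -
    obtain F where F: "F \<in> feasible (delete D e)" "dist_feasible (delete D e) A = card (sym_diff A F)"
      using dist_feasible_attained[OF delta_matroid_delete[OF D]] .
    have "dist_feasible D A = card (sym_diff A F)"
    proof (rule dist_feasible_eqI[OF D])
      show "F \<in> feasible D" using F True by (auto simp: feasible_delete[OF D])
      fix G assume "G \<in> feasible D"
      then obtain Z where Z: "Z \<in> feasible D" "e \<notin> Z" "card (sym_diff A Z) \<le> card (sym_diff A G)"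
        using exchange_nearer[OF D X] A by (metis Diff_subset subset_Diff_insert subset_trans)
      have "Z \<in> feasible (delete D e)" using Z True by (auto simp: feasible_delete[OF D])
      then have "card (sym_diff A F) \<le> card (sym_diff A Z)"
        using dist_feasible_le[OF delta_matroid_delete[OF D]] F(2) by metis
      with Z(3) show "card (sym_diff A F) \<le> card (sym_diff A G)" by linarith
    qed
    then show ?thesis using F by simp
  qed
  then show thesis using that[of 0] by simp
next
  case False
  have "dist_feasible D A = dist_feasible (delete D e) A + 1" if A: "A \<subseteq> ground D - {e}" for A
  proof -
    \<comment> \<open>Every feasible set contains \<open>e\<close> and \<open>A\<close> does not, so
      the deletion lowers each distance by exactly one.\<close>
    have card: "card (sym_diff A F) = card (sym_diff A (F - {e})) + 1" if "F \<in> feasible D" for F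
    proof -
      have F: "F \<subseteq> ground D" "finite (ground D)" "e \<in> F"
        using D that False by (auto simp: delta_matroid_def)
      have fin: "finite (sym_diff A F)" by (rule finite_subset[OF _ F(2)]) (use F A in auto)
      have "sym_diff A (F - {e}) = sym_diff A F - {e}" using A by auto
      moreover have "e \<in> sym_diff A F" using F(3) A by blast
      ultimately show ?thesis using card_Suc_Diff1[OF fin] by (metis Suc_eq_plus1)
    qed
    obtain F where F: "F \<in> feasible D" "dist_feasible D A = card (sym_diff A F)"
      using dist_feasible_attained[OF D] .
    have "dist_feasible (delete D e) A = card (sym_diff A (F - {e}))"
    proof (rule dist_feasible_eqI[OF delta_matroid_delete[OF D]])
      show "F - {e} \<in> feasible (delete D e)" using F False by (auto simp: feasible_delete[OF D])
      fix G assume "G \<in> feasible (delete D e)"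
      then obtain H where H: "G = H - {e}" "H \<in> feasible D"
        using False by (auto simp: feasible_delete[OF D])
      show "card (sym_diff A (F - {e})) \<le> card (sym_diff A G)"
        using card[OF F(1)] card[OF H(2)] dist_feasible_le[OF D H(2), of A] F(2) H(1) by simp
    qed
    then show ?thesis using F card by simp
  qed
  then show thesis using that[of 1] by simp
qed

text \<open>The constants of the single deletions add up. What matters is that \<open>k\<close> does
  not depend on \<open>A\<close>: it cancels when \<open>A\<close> is compared with
  \<open>{}\<close>.\<close>

lemma dist_feasible_delete_set:
  assumes D: "delta_matroid D" and X: "X \<subseteq> ground D"
  shows "ground (delete_set D X) = ground D - X \<and>
    (\<exists>k. \<forall>A. A \<subseteq> ground D - X \<longrightarrow> dist_feasible D A = dist_feasible (delete_set D X) A + k)"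
proof -
  have "finite X" using assms finite_subset by (auto simp: delta_matroid_def)
  then show ?thesis using X
  proof induction
    case empty
    show ?case by (auto simp: delete_set_def)
  next
    case (insert e X)
    note ds = delete_set_insert[OF D insert.hyps] delta_matroid_delete_set[OF D insert.hyps(1)]
    obtain k where g: "ground (delete_set D X) = ground D - X"
      and k: "\<And>A. A \<subseteq> ground D - X \<Longrightarrow> dist_feasible D A = dist_feasible (delete_set D X) A + k"
      using insert by auto
    have "e \<in> ground (delete_set D X)" using g insert by auto
    then obtain l where l: "\<And>A. A \<subseteq> ground D - X - {e} \<Longrightarrow>
        dist_feasible (delete_set D X) A = dist_feasible (delete_set D (insert e X)) A + l"
      using dist_feasible_delete[OF ds(2)] g unfolding ds(1) by metis
    have "dist_feasible D A = dist_feasible (delete_set D (insert e X)) A + (l + k)"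
      if "A \<subseteq> ground D - insert e X" for A
    proof -
      have "A \<subseteq> ground D - X" "A \<subseteq> ground D - X - {e}" using that by auto
      then show ?thesis using k l by simp
    qed
    moreover have "ground (delete_set D (insert e X)) = ground D - insert e X"
      using g unfolding ds(1) by auto
    ultimately show ?case by blast
  qed
qed

section \<open>Extreme cardinalities of restrictions in terms of distances\<close>

lemma r_min_eq_dist: "r_min D = dist_feasible D {}"
  unfolding r_min_def dist_feasible_def by simp

text \<open>The distance of a feasible set from the ground set is the number of points it misses, so
  the nearest feasible sets are the largest ones.\<close>

lemma r_max_plus_dist:
  assumes D: "delta_matroid D"
  shows "r_max D + dist_feasible D (ground D) = card (ground D)"
proof -
  have fin: "finite (feasible D)" using delta_matroid_finite_feasible[OF D] .
  have card: "card F + card (sym_diff (ground D) F) = card (ground D)" if "F \<in> feasible D" for F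
  proof -
    have F: "F \<subseteq> ground D" "finite (ground D)" using that D by (auto simp: delta_matroid_def)
    then have "sym_diff (ground D) F = ground D - F" by auto
    then show ?thesis using F by (simp add: card_Diff_subset finite_subset card_mono)
  qed
  obtain F where F: "F \<in> feasible D" "dist_feasible D (ground D) = card (sym_diff (ground D) F)"
    using dist_feasible_attained[OF D] .
  have "r_max D = card F"
    unfolding r_max_def
  proof (rule Max_eqI)
    fix n assume "n \<in> card ` feasible D"
    then obtain G where G: "G \<in> feasible D" "n = card G" by auto
    show "n \<le> card F"
      using card[OF F(1)] card[OF G(1)] dist_feasible_le[OF D G(1), of "ground D"] F(2) G(2) by linarith
  qed (use fin F in auto)
  then show ?thesis using card[OF F(1)] F(2) by simp
qed

text \<open>The formula \<open>2 \<sigma>(A) = |A| + d({}) - d(A)\<close> without subtraction. On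
  the restriction, both extreme cardinalities are read off from distances, and the constant
  \<open>k\<close> enters once through \<open>A\<close> and once through \<open>{}\<close>.\<close>

lemma r_max_r_min_restrict:
  assumes D: "delta_matroid D" and A: "A \<subseteq> ground D"
  shows "r_max (restrict_to D A) + r_min (restrict_to D A) + dist_feasible D A
    = card A + r_min D"
proof -
  let ?X = "ground D - A"
  have "finite ?X" using D by (auto simp: delta_matroid_def)
  then have dm: "delta_matroid (delete_set D ?X)"
    by (rule delta_matroid_delete_set[OF D])
  have "ground (delete_set D ?X) = A" 
    using dist_feasible_delete_set[OF D, of ?X] A by auto
  moreover obtain k where k: "\<And>B. B \<subseteq> A \<Longrightarrow> dist_feasible D B = dist_feasible (delete_set D ?X) B + k"
    using dist_feasible_delete_set[OF D, of ?X] A by (auto simp: double_diff)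
  ultimately show ?thesis
    using r_max_plus_dist[OF dm] k[of A] k[of "{}"] unfolding restrict_to_def r_min_eq_dist by simp
qed

section \<open>Active orientable points\<close>

definition active_orientable :: "'a set_system \<Rightarrow> 'a rel \<Rightarrow> 'a set \<Rightarrow> 'a set" where
  "active_orientable D r F = {a \<in> ground D. active D r F a \<and> \<not> nonorientable D F a}"

text \<open>For orientable \<open>a\<close>, being interlaced with \<open>b\<close> just means being
  paired with it. The instance \<open>b = a\<close> concerns the set \<open>{a}\<close> and thus
  expresses orientability.\<close>

lemma active_orientable_iff:
  "a \<in> active_orientable D r F \<longleftrightarrow> a \<in> ground D \<and>
    (\<forall>b\<in>ground D. b = a \<or> (b, a) \<in> r \<longrightarrow> sym_diff F {a, b} \<notin> feasible D)"
proof -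
  define P where "P B \<longleftrightarrow> B \<in> feasible (twist D F)" for B
  have "sym_diff F B \<in> feasible D \<longleftrightarrow> P B" for B by (simp add: P_def feasible_twist_iff)
  moreover have "nonorientable D F b \<longleftrightarrow> P {b}" "paired D F b c \<longleftrightarrow> b \<noteq> c \<and> P {b, c}" for b c
    by (simp_all add: nonorientable_def paired_def P_def)
  ultimately show ?thesis
    unfolding active_orientable_def active_def interlaced_def by auto
qed

lemma finite_total_greatest:
  assumes "finite K" "K \<noteq> {}" "total_on K r" "trans r"
  obtains e where "e \<in> K" "\<And>a. a \<in> K \<Longrightarrow> a \<noteq> e \<Longrightarrow> (a, e) \<in> r"
proof -
  have "\<exists>e\<in>K. \<forall>a\<in>K. a \<noteq> e \<longrightarrow> (a, e) \<in> r"
    using assms(1-3)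
  proof (induction rule: finite_ne_induct)
    case (insert x K)
    have "total_on K r" using insert.prems by (auto simp: total_on_def)
    then obtain e where e: "e \<in> K" "\<forall>a\<in>K. a \<noteq> e \<longrightarrow> (a, e) \<in> r"
      using insert.IH by blast
    have "x \<noteq> e" using e insert by auto
    then consider "(x, e) \<in> r" | "(e, x) \<in> r"
      using insert.prems e by (auto simp: total_on_def)
    then show ?case
    proof cases
      case 1
      then show ?thesis using e by (intro bexI[of _ e]) auto
    next
      case 2
      have "(a, x) \<in> r" if "a \<in> K" for a
        using 2 e(2) that transD[OF \<open>trans r\<close>, of a e x] by (cases "a = e") auto
      then show ?thesis by (intro bexI[of _ x]) auto
    qed
  qed simp
  then show thesis using that by blast
qed

text \<open>Membership of the greatest point \<open>e\<close> rules out every exchange of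
  \<open>F\<close> at \<open>e\<close>, but the exchange axiom provides one as soon as some feasible
  set disagrees with \<open>F\<close> on \<open>e\<close>.\<close>

lemma not_active_orientable_greatest:
  assumes D: "delta_matroid D" and gr: "\<And>a. a \<in> ground D \<Longrightarrow> a \<noteq> e \<Longrightarrow> (a, e) \<in> r"
    and F: "F \<in> feasible D" and X: "X \<in> feasible D" and e: "e \<in> sym_diff F X"
  shows "e \<notin> active_orientable D r F"
proof
  assume act: "e \<in> active_orientable D r F"
  obtain b where b: "b \<in> sym_diff F X" "sym_diff F {e, b} \<in> feasible D"
    using delta_matroid_exchange[OF D F X e] .
  have "b \<in> ground D" using b(1) D F X unfolding delta_matroid_def by blast
  then show False using b act gr unfolding active_orientable_iff by blast
qed

section \<open>Decomposition into Boolean intervals\<close>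

text \<open>The case \<open>A = {}\<close> of the decomposition, where minimality of
  \<open>F\<close> says \<open>d({}) = |F|\<close>. Induction deletes the greatest point, against
  which no other point is tested for activity.\<close>

lemma ex1_subset_active_orientable:
  assumes "delta_matroid D" "total_on (ground D) r" "trans r" "antisym r"
  shows "\<exists>F. F \<in> feasible D \<and> F \<subseteq> active_orientable D r F \<and> (\<forall>Y\<in>feasible D. card F \<le> card Y) \<and>
    (\<forall>G\<in>feasible D. G \<subseteq> active_orientable D r G \<longrightarrow> G = F)"
  using assms
proof (induction "card (ground D)" arbitrary: D)
  case 0
  then have "ground D = {}" by (auto simp: delta_matroid_def)
  then have "feasible D = {{}}" using 0 by (auto simp: delta_matroid_def)
  then show ?case by auto
next
  case (Suc n)
  note D = \<open>delta_matroid D\<close>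
  have fin: "finite (ground D)" "ground D \<noteq> {}" using D Suc(2) by (auto simp: delta_matroid_def)
  obtain e where e: "e \<in> ground D" "\<And>a. a \<in> ground D \<Longrightarrow> a \<noteq> e \<Longrightarrow> (a, e) \<in> r"
    using finite_total_greatest[OF fin] Suc.prems by blast
  have ne: "(e, a) \<notin> r" if "a \<in> ground D" "a \<noteq> e" for a
    using that e \<open>antisym r\<close> by (auto dest: antisymD)
  note D' = delta_matroid_delete[OF D, of e]
  have "n = card (ground (delete D e))" using Suc(2) e fin by simp
  moreover have "total_on (ground (delete D e)) r"
    using \<open>total_on (ground D) r\<close> by (auto simp: total_on_def)
  ultimately have "\<exists>F. F \<in> feasible (delete D e) \<and> F \<subseteq> active_orientable (delete D e) r F \<and>
      (\<forall>Y\<in>feasible (delete D e). card F \<le> card Y) \<and>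
      (\<forall>G\<in>feasible (delete D e). G \<subseteq> active_orientable (delete D e) r G \<longrightarrow> G = F)"
    using Suc.prems(3,4) by (intro Suc.hyps(1) D')
  then obtain F where F: "F \<in> feasible (delete D e)" "F \<subseteq> active_orientable (delete D e) r F"
     "\<forall>Y\<in>feasible (delete D e). card F \<le> card Y"
     "\<forall>G\<in>feasible (delete D e). G \<subseteq> active_orientable (delete D e) r G \<longrightarrow> G = F"
    by (elim exE conjE) (rule that)
  note F_unique = F(4)[THEN bspec, THEN mp]
  note fd = feasible_delete[OF D, of e]
  show ?case
  proof (cases "\<exists>F\<in>feasible D. e \<notin> F")
    case True
    then obtain X where X: "X \<in> feasible D" "e \<notin> X" by blast
    \<comment> \<open>For \<open>a\<close> and \<open>b\<close> other than \<open>e\<close>, the set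
      to be tested avoids \<open>e\<close>, hence is feasible in \<open>D\<close> iff it is feasible
      in the deletion.\<close>
    have act: "active_orientable (delete D e) r G = active_orientable D r G - {e}"
      if "e \<notin> G" for G
      using that True ne unfolding set_eq_iff active_orientable_iff Diff_iff by (auto simp: fd)
    have FD: "F \<in> feasible D" "e \<notin> F" using F(1) True by (auto simp: fd)
    show ?thesis
    proof (intro exI[of _ F] conjI ballI impI)
      show "F \<in> feasible D" by fact
      show "F \<subseteq> active_orientable D r F" using F(2) act FD by blast
      fix Y assume Y: "Y \<in> feasible D"
      \<comment> \<open>Distance from \<open>{}\<close> is cardinality, so some feasible set
        avoiding \<open>e\<close> is no larger than \<open>Y\<close>.\<close>
      obtain Z where Z: "Z \<in> feasible D" "e \<notin> Z" "card (sym_diff {} Z) \<le> card (sym_diff {} Y)"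
        using exchange_nearer[OF D X Y, of "{}"] by blast
      then have "Z \<in> feasible (delete D e)" by (auto simp: fd)
      then show "card F \<le> card Y" using F(3) Z(3) by fastforce
      assume Ya: "Y \<subseteq> active_orientable D r Y"
      have "e \<notin> Y" using not_active_orientable_greatest[OF D e(2) Y X(1)] X(2) Ya by blast
      then show "Y = F" using Ya act Y F_unique[of Y] True by (auto simp: fd)
    qed
  next
    case False
    have e_in: "e \<in> H" if "H \<in> feasible D" for H using False that by blast
    \<comment> \<open>A coloop is always active and orientable, since toggling it never gives a
      feasible set. Removing it from all feasible sets is injective and preserves the tests of the
      other points.\<close>
    have act: "active_orientable D r G = insert e (active_orientable (delete D e) r (G - {e}))"
      if "G \<in> feasible D" for G
    proof -
      have *: "sym_diff (G - {e}) {a, b} \<in> feasible (delete D e) \<longleftrightarrow> sym_diff G {a, b} \<in> feasible D"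
        if ab: "a \<noteq> e" "b \<noteq> e" for a b
      proof -
        have "sym_diff (G - {e}) {a, b} = H - {e} \<longleftrightarrow> H = sym_diff G {a, b}" if "H \<in> feasible D" for H
          using e_in[OF that] e_in[OF \<open>G \<in> feasible D\<close>] ab by auto
        then show ?thesis using False unfolding fd by (auto simp: image_iff)
      qed
      have "sym_diff G {e, b} \<notin> feasible D" for b
        using e_in[of "sym_diff G {e, b}"] e_in[OF \<open>G \<in> feasible D\<close>] by blast
      then have "e \<in> active_orientable D r G" using e(1) unfolding active_orientable_iff by blast
      moreover have "a \<in> active_orientable D r G \<longleftrightarrow> a \<in> active_orientable (delete D e) r (G - {e})"
        if "a \<noteq> e" for a
      proof -
        define P where "P b \<longleftrightarrow> sym_diff G {a, b} \<in> feasible D" for b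
        define P' where "P' b \<longleftrightarrow> sym_diff (G - {e}) {a, b} \<in> feasible (delete D e)" for b
        have "P' b \<longleftrightarrow> P b" if "b \<noteq> e" for b using *[OF \<open>a \<noteq> e\<close> that] by (simp only: P_def P'_def)
        then show ?thesis
          unfolding active_orientable_iff P_def[symmetric] P'_def[symmetric] using \<open>a \<noteq> e\<close> ne[of a] by auto
      qed
      ultimately show ?thesis by (intro set_eqI) (metis insert_iff)
    qed
    obtain G where G: "G \<in> feasible D" "F = G - {e}" using F(1) False by (auto simp: fd)
    show ?thesis
    proof (intro exI[of _ G] conjI ballI impI)
      show "G \<in> feasible D" by fact
      show "G \<subseteq> active_orientable D r G" using F(2) act G by blast
      fix Y assume Y: "Y \<in> feasible D"
      have Y': "Y - {e} \<in> feasible (delete D e)" using False Y by (auto simp: fd)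
      have finH: "finite H" if "H \<in> feasible D" for H
        using that D finite_subset unfolding delta_matroid_def by metis
      have "card (G - {e}) \<le> card (Y - {e})" using Y' F(3) G(2) by blast
      then show "card G \<le> card Y"
        using card_Suc_Diff1[OF finH[OF Y] e_in[OF Y]]
          card_Suc_Diff1[OF finH[OF G(1)] e_in[OF G(1)]] by simp
      assume "Y \<subseteq> active_orientable D r Y"
      then have "Y - {e} = F" using act[OF Y] F_unique[OF Y'] by blast
      then show "Y = G" using G e_in[OF Y] e_in[OF G(1)] by blast
    qed
  qed
qed

text \<open>The tests at \<open>F\<close> see only \<open>twist D F\<close>, and twisting by
  \<open>A\<close> and then by \<open>sym_diff A F\<close> gives the same system.\<close>

lemma active_orientable_twist:
  "active_orientable (twist D A) r (sym_diff A F) = active_orientable D r F"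
proof -
  have *: "sym_diff A (sym_diff (sym_diff A F) B) = sym_diff F B" for B by blast
  have "ground (twist D A) = ground D" by (simp add: twist_def)
  then show ?thesis
    by (intro set_eqI) (simp only: active_orientable_iff feasible_twist_iff *)
qed

text \<open>Twisting by \<open>A\<close> moves \<open>A\<close> to \<open>{}\<close> and turns
  distances from \<open>A\<close> into cardinalities, while active orientable points are
  preserved.\<close>

lemma active_orientable_decomposition:
  assumes D: "delta_matroid D" and "total_on (ground D) r" "trans r" "antisym r"
    and A: "A \<subseteq> ground D"
  shows "\<exists>!F. F \<in> feasible D \<and> sym_diff A F \<subseteq> active_orientable D r F"
    and "F \<in> feasible D \<Longrightarrow> sym_diff A F \<subseteq> active_orientable D r F \<Longrightarrow>
      dist_feasible D A = card (sym_diff A F)"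
proof -
  have "total_on (ground (twist D A)) r" using assms by (simp add: twist_def)
  from ex1_subset_active_orientable[OF delta_matroid_twist[OF D A] this assms(3,4)]
  obtain H where H: "H \<in> feasible (twist D A)" "H \<subseteq> active_orientable (twist D A) r H"
    "\<forall>Y\<in>feasible (twist D A). card H \<le> card Y"
    "\<forall>G\<in>feasible (twist D A). G \<subseteq> active_orientable (twist D A) r G \<longrightarrow> G = H"
    by (elim exE conjE) (rule that)
  have tw: "sym_diff A G \<in> feasible (twist D A)" if "G \<in> feasible D" for G
    using that by (auto simp: twist_def)
  have uniq: "G = sym_diff A H" if "G \<in> feasible D" "sym_diff A G \<subseteq> active_orientable D r G" for G
  proof -
    have "sym_diff A G = H"
      using H(4)[THEN bspec, THEN mp, OF tw[OF that(1)]] that(2) unfolding active_orientable_twist .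
    then show ?thesis by blast
  qed
  have HD: "sym_diff A H \<in> feasible D" using H(1) by (simp add: feasible_twist_iff)
  have cancel: "sym_diff A (sym_diff A H) = H" by blast
  have Hact: "sym_diff A (sym_diff A H) \<subseteq> active_orientable D r (sym_diff A H)"
    using H(2) active_orientable_twist[of D A r "sym_diff A H"] unfolding cancel by simp
  show "\<exists>!F. F \<in> feasible D \<and> sym_diff A F \<subseteq> active_orientable D r F"
  proof (rule ex1I)
    show "sym_diff A H \<in> feasible D \<and>
        sym_diff A (sym_diff A H) \<subseteq> active_orientable D r (sym_diff A H)"
      using HD Hact by (rule conjI)
  qed (elim conjE, rule uniq)
  assume F: "F \<in> feasible D" "sym_diff A F \<subseteq> active_orientable D r F"
  have "sym_diff A F = H" using uniq[OF F] by blast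
  then show "dist_feasible D A = card (sym_diff A F)"
    using H(3) tw by (intro dist_feasible_eqI[OF D F(1)]) metis
qed

section \<open>Summation over the intervals\<close>

text \<open>For \<open>m < n\<close>, \<open>nat\<close> and natural subtraction both truncate the
  exponent to 0.\<close>

lemma half_pow_half_diff: "half_pow s ((of_nat m - of_nat n) / 2) = s ^ (m - n)"
proof -
  have "2 * ((of_nat m - of_nat n) / 2 :: rat) = of_int (int m - int n)" by simp
  then have "\<lfloor>2 * ((of_nat m - of_nat n) / 2 :: rat)\<rfloor> = int m - int n"
    by (simp only: floor_of_int)
  then show ?thesis by (simp add: half_pow_def nat_diff_distrib')
qed

text \<open>Expand the product over \<open>K\<close> of \<open>w + 1\<close>, where the weight
  \<open>w\<close> is \<open>u\<close> on \<open>F\<close> and \<open>v\<close> off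
  \<open>F\<close>.\<close>

lemma sum_Pow_power_card:
  fixes u v :: "'b::comm_ring_1"
  assumes "finite K"
  shows "(\<Sum>B\<in>Pow K. u ^ card (B \<inter> F) * v ^ card (B - F)) = (u + 1) ^ card (K \<inter> F) * (v + 1) ^ card (K - F)"
proof -
  have split: "(\<Prod>a\<in>B. if a \<in> F then p else q) = p ^ card (B \<inter> F) * q ^ card (B - F)"
    if "finite B" for B and p q :: 'b
    using that by (simp add: prod.If_cases Collect_conj_eq Diff_eq)
  have "(u + 1) ^ card (K \<inter> F) * (v + 1) ^ card (K - F) = (\<Prod>a\<in>K. (if a \<in> F then u else v) + 1)"
    using split[OF assms, of "u + 1" "v + 1"] by (simp add: if_distrib[of "\<lambda>z. z + 1"] cong: if_cong)
  also have "\<dots> = (\<Sum>B\<in>Pow K. \<Prod>a\<in>B. if a \<in> F then u else v)"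
    using assms by (simp add: prod_add)
  also have "\<dots> = (\<Sum>B\<in>Pow K. u ^ card (B \<inter> F) * v ^ card (B - F))"
    using assms by (intro sum.cong refl split) (auto intro: finite_subset)
  finally show ?thesis by simp
qed

lemma card_r_bounds:
  assumes "delta_matroid D" "F \<in> feasible D"
  shows "r_min D \<le> card F" "card F \<le> r_max D"
  using assms delta_matroid_finite_feasible[OF assms(1)] unfolding r_min_def r_max_def by auto

text \<open>With \<open>A = sym_diff F B\<close>, \<open>d(A) = |B|\<close> gives
  \<open>2 \<sigma>(A) = |F| + r_min D - 2 |B \<inter> F|\<close>. The doubled exponents thus split
  into a part from \<open>F\<close> and an even part from \<open>B\<close>.\<close>

lemma bollobas_riordan_term:
  fixes s t :: "'b::comm_ring_1"
  assumes D: "delta_matroid D" and r: "total_on (ground D) r" "trans r" "antisym r"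
    and F: "F \<in> feasible D" and B: "B \<subseteq> active_orientable D r F"
  shows "half_pow s (sigma_sub D (ground D) - sigma_sub D (sym_diff F B)) *
      half_pow t (of_nat (card (sym_diff F B)) - sigma_sub D (sym_diff F B)) =
    s ^ (r_max D - card F) * t ^ (card F - r_min D) * ((s ^ 2) ^ card (B \<inter> F) * (t ^ 2) ^ card (B - F))"
proof -
  let ?A = "sym_diff F B"
  let ?R = "r_max (restrict_to D ?A) + r_min (restrict_to D ?A)"
  have sub: "F \<subseteq> ground D" "B \<subseteq> ground D" and fin: "finite (ground D)"
    using D F B by (auto simp: delta_matroid_def active_orientable_def)
  have finFB: "finite F" "finite B" using sub fin finite_subset by auto
  have A: "?A \<subseteq> ground D" using sub by auto
  have AF: "sym_diff ?A F = B" by blast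
  have "dist_feasible D ?A = card B"
    using active_orientable_decomposition(2)[OF D r A F] AF B by simp
  then have R: "?R + card B = card ?A + r_min D"
    using r_max_r_min_restrict[OF D A] by simp
  have cB: "card B = card (B \<inter> F) + card (B - F)"
    using card_Int_Diff[OF finFB(2)] .
  have cF: "card F = card (B \<inter> F) + card (F - B)"
    using card_Int_Diff[OF finFB(1), of B] by (simp add: Int_commute)
  have cA: "card ?A = card (F - B) + card (B - F)"
    using finFB by (intro card_Un_disjoint) auto
  note bounds = card_r_bounds[OF D F]
  \<comment> \<open>The bounds on \<open>card F\<close> keep the natural subtractions in
    \<open>e1\<close> and \<open>e2\<close> from truncating.\<close>
  have e1: "r_max D + r_min D - ?R = (r_max D - card F) + 2 * card (B \<inter> F)"
    using R cB cF cA bounds by linarith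
  have e2: "2 * card ?A - ?R = (card F - r_min D) + 2 * card (B - F)"
    using R cB cF cA bounds by linarith
  have "restrict_to D (ground D) = D" by (simp add: restrict_to_def delete_set_def)
  then have "sigma_sub D (ground D) - sigma_sub D ?A = (of_nat (r_max D + r_min D) - of_nat ?R) / 2"
    by (simp add: sigma_sub_def sigma_def diff_divide_distrib)
  moreover have "of_nat (card ?A) - sigma_sub D ?A = (of_nat (2 * card ?A) - of_nat ?R) / 2"
    by (simp add: sigma_sub_def sigma_def diff_divide_distrib)
  ultimately show ?thesis
    by (simp only: half_pow_half_diff e1 e2 power_add power_mult mult_ac)
qed

theorem theorem5p9:
  fixes D :: "'a set_system" and r :: "'a rel" and x y s t :: "'b::comm_ring_1"
  assumes "delta_matroid D"
    and "linear_order_on (ground D) r"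
    and "s ^ 2 = x - 1" and "t ^ 2 = y - 1"
  shows "bollobas_riordan D s t =
    (\<Sum>F\<in>feasible D.
       half_pow s ((of_nat (r_max D) - of_nat (card F)) / 2) *
       half_pow t ((of_nat (card F) - of_nat (r_min D)) / 2) *
       x ^ int_activity D r F * y ^ ext_activity D r F)"
proof -
  note D = assms(1)
  have r: "total_on (ground D) r" "trans r" "antisym r"
    using assms(2) by (auto simp: order_on_defs)
  have fin: "finite (ground D)" "finite (feasible D)"
    using D delta_matroid_finite_feasible[OF D] by (auto simp: delta_matroid_def)
  have finact: "finite (active_orientable D r F)" for F
    using fin(1) by (simp add: active_orientable_def)
  let ?h = "\<lambda>A. half_pow s (sigma_sub D (ground D) - sigma_sub D A) *
      half_pow t (of_nat (card A) - sigma_sub D A)"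
  let ?S = "SIGMA F:feasible D. Pow (active_orientable D r F)"
  \<comment> \<open>For fixed \<open>A = sym_diff F B\<close>, \<open>B\<close> is recovered from
    \<open>F\<close> as \<open>sym_diff A F\<close>, so existence and uniqueness of \<open>F\<close>
    give surjectivity and injectivity.\<close>
  have bij: "bij_betw (\<lambda>(F, B). sym_diff F B) ?S (Pow (ground D))"
  proof (rule bij_betwI')
    fix p q assume p: "p \<in> ?S" and q: "q \<in> ?S"
    obtain F B G C where [simp]: "p = (F, B)" "q = (G, C)" by fastforce
    show "((case p of (F, B) \<Rightarrow> sym_diff F B) = (case q of (F, B) \<Rightarrow> sym_diff F B)) = (p = q)"
    proof
      assume "(case p of (F, B) \<Rightarrow> sym_diff F B) = (case q of (F, B) \<Rightarrow> sym_diff F B)"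
      then have eq: "sym_diff F B = sym_diff G C" by simp
      let ?A = "sym_diff F B"
      have B: "sym_diff ?A F = B" by blast
      have C: "sym_diff ?A G = C" unfolding eq by blast
      have "?A \<subseteq> ground D"
        using p D by (auto simp: delta_matroid_def active_orientable_def)
      note ex1 = active_orientable_decomposition(1)[OF D r this]
      have "F \<in> feasible D \<and> sym_diff ?A F \<subseteq> active_orientable D r F"
        "G \<in> feasible D \<and> sym_diff ?A G \<subseteq> active_orientable D r G"
        unfolding B C using p q by auto
      with ex1 have "F = G" by blast
      with B C show "p = q" by simp
    qed simp
  next
    fix p assume "p \<in> ?S"
    then show "(case p of (F, B) \<Rightarrow> sym_diff F B) \<in> Pow (ground D)"
      using D by (auto simp: delta_matroid_def active_orientable_def)
  next
    fix A assume "A \<in> Pow (ground D)"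
    then have "A \<subseteq> ground D" by simp
    from active_orientable_decomposition(1)[OF D r this]
    obtain F where "F \<in> feasible D" "sym_diff A F \<subseteq> active_orientable D r F"
      by (elim ex1E conjE) (rule that)
    moreover have "A = sym_diff F (sym_diff A F)" by blast
    ultimately show "\<exists>p\<in>?S. A = (case p of (F, B) \<Rightarrow> sym_diff F B)"
      by (intro bexI[of _ "(F, sym_diff A F)"]) auto
  qed
  have "bollobas_riordan D s t = (\<Sum>(F, B)\<in>?S. ?h (sym_diff F B))"
    unfolding bollobas_riordan_def
    using sum.reindex_bij_betw[OF bij, of ?h] by (simp add: case_prod_unfold)
  also have "\<dots> = (\<Sum>F\<in>feasible D. \<Sum>B\<in>Pow (active_orientable D r F). ?h (sym_diff F B))"
    using fin finact by (subst sum.Sigma) auto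
  also have "\<dots> = (\<Sum>F\<in>feasible D. s ^ (r_max D - card F) * t ^ (card F - r_min D) *
      (\<Sum>B\<in>Pow (active_orientable D r F). (s ^ 2) ^ card (B \<inter> F) * (t ^ 2) ^ card (B - F)))"
    unfolding sum_distrib_left
    by (intro sum.cong refl bollobas_riordan_term[OF D r]) auto
  \<comment> \<open>Here \<open>s ^ 2 + 1 = x\<close> and \<open>t ^ 2 + 1 = y\<close>, so each
    interval sums to powers of \<open>x\<close> and \<open>y\<close>.\<close>
  also have "\<dots> = (\<Sum>F\<in>feasible D. s ^ (r_max D - card F) * t ^ (card F - r_min D) *
      (x ^ card (active_orientable D r F \<inter> F) * y ^ card (active_orientable D r F - F)))"
    by (simp add: sum_Pow_power_card[OF finact] assms(3,4))
  also have "\<dots> = (\<Sum>F\<in>feasible D.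
       half_pow s ((of_nat (r_max D) - of_nat (card F)) / 2) *
       half_pow t ((of_nat (card F) - of_nat (r_min D)) / 2) *
       x ^ int_activity D r F * y ^ ext_activity D r F)"
  proof (rule sum.cong[OF refl])
    fix F
    have "active_orientable D r F \<inter> F = {a \<in> ground D. a \<in> F \<and> active D r F a \<and> \<not> nonorientable D F a}"
      "active_orientable D r F - F = {a \<in> ground D. a \<notin> F \<and> active D r F a \<and> \<not> nonorientable D F a}"
      by (auto simp: active_orientable_def)
    then show "s ^ (r_max D - card F) * t ^ (card F - r_min D) *
        (x ^ card (active_orientable D r F \<inter> F) * y ^ card (active_orientable D r F - F)) =
       half_pow s ((of_nat (r_max D) - of_nat (card F)) / 2) *
       half_pow t ((of_nat (card F) - of_nat (r_min D)) / 2) *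
       x ^ int_activity D r F * y ^ ext_activity D r F"
      by (simp add: half_pow_half_diff int_activity_def ext_activity_def mult.assoc)
  qed
  finally show ?thesis .
qed

end
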